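(* Let $a$ be an $n\times m$ and $b$ an $m\times n$ constant complex matrix with $ba=0$, and let $u=\mathrm{diag}(u_1,\dots,u_n)$. If $bua$ is invertible (thus $\mathrm{rank}\,a=\mathrm{rank}\,b=m\le\frac n2$), then the $n\times n$ matrix function $$\Phi_n(u)=\mathrm{ad}_u\Big(a\,(bua)^{-1}\,b\Big)$$ is a rational solution of the $n$-th isomonodromy equation $$\frac{\partial}{\partial u_k}\Phi(u)=[\mathrm{ad}_u^{-1}\mathrm{ad}_{E_k}\Phi(u),\Phi(u)],\quad k=1,\dots,n.$$ The matrix $\Phi_n(u)$ is diagonalizable and has eigenvalues $1,-1,0$ with multiplicities $m,m,n-2m$, and its spectral projections onto the eigenspaces for $1,-1,0$ are respectively $$\mathcal P_1=\Big(I-\tfrac12a(bua)^{-1}bu\Big)\Big(ua(bua)^{-1}b\Big)=ua(bua)^{-1}b-a(bua)^{-1}\tfrac{bu^2a}{2}(bua)^{-1}b,$$ $$\mathcal P_{-1}=\Big(a(bua)^{-1}bu\Big)\Big(I-\tfrac12ua(bua)^{-1}b\Big)=a(bua)^{-1}bu-a(bua)^{-1}\tfrac{bu^2a}{2}(bua)^{-1}b,$$ $$\mathcal P_0=\Big(I-a(bua)^{-1}bu\Big)\Big(I-ua(bua)^{-1}b\Big).$$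
   Context: $\mathrm{ad}_AB=[A,B]=AB-BA$. $E_k$ is the $k$-th diagonal matrix unit. For $u$ with distinct diagonal entries, $(\mathrm{ad}_u^{-1}A)_{ij}=A_{ij}/(u_i-u_j)$ if $i\ne j$ and $0$ if $i=j$. The equation is considered at points $u$ with distinct $u_1,\dots,u_n$ for which $bua$ is invertible. *)

theory Defs
  imports "HOL-Analysis.Analysis" "HOL-Computational_Algebra.Polynomial"
begin

definition ad :: "'a::ring_1^'n^'n \<Rightarrow> 'a^'n^'n \<Rightarrow> 'a^'n^'n" where
  "ad A B = A ** B - B ** A"

definition diag_mat :: "'a::zero^'n \<Rightarrow> 'a^'n^'n" where
  "diag_mat u = (\<chi> i j. if i = j then u $ i else 0)"

definition diag_unit :: "'n \<Rightarrow> complex^'n^'n" where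
  "diag_unit k = diag_mat (axis k 1)"

text \<open>Only meaningful as an inverse of \<open>ad (diag_mat u)\<close> (on matrices with zero diagonal)
  when the entries of \<open>u\<close> are pairwise distinct.\<close>

definition ad_inv :: "complex^'n \<Rightarrow> complex^'n^'n \<Rightarrow> complex^'n^'n" where
  "ad_inv u A = (\<chi> i j. if i = j then 0 else A $ i $ j / (u $ i - u $ j))"

text \<open>The partial derivative with respect to \<open>u\<^sub>k\<close> is the complex derivative, entry by entry, of
  \<open>\<Phi>\<close> along the line on which only the \<open>k\<close>-th coordinate varies.\<close>

definition isomonodromy_solution_on ::
    "(complex^'n) set \<Rightarrow> (complex^'n \<Rightarrow> complex^'n^'n) \<Rightarrow> bool" where
  "isomonodromy_solution_on S \<Phi> \<longleftrightarrow>
     (\<forall>u\<in>S. \<forall>k i j.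
        ((\<lambda>z. \<Phi> (\<chi> l. if l = k then z else u $ l) $ i $ j) has_field_derivative
           ad (ad_inv u (ad (diag_unit k) (\<Phi> u))) (\<Phi> u) $ i $ j) (at (u $ k)))"

inductive polynomial_fun :: "(complex^'n \<Rightarrow> complex) \<Rightarrow> bool" where
  const: "polynomial_fun (\<lambda>u. c)"
| coord: "polynomial_fun (\<lambda>u. u $ i)"
| add: "polynomial_fun p \<Longrightarrow> polynomial_fun q \<Longrightarrow> polynomial_fun (\<lambda>u. p u + q u)"
| mult: "polynomial_fun p \<Longrightarrow> polynomial_fun q \<Longrightarrow> polynomial_fun (\<lambda>u. p u * q u)"

text \<open>The entries are quotients of polynomials in \<open>u\<^sub>1, \<dots>, u\<^sub>n\<close> whose denominators have no zero
  on \<open>S\<close>.\<close>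

definition rational_on :: "(complex^'n) set \<Rightarrow> (complex^'n \<Rightarrow> complex^'n^'n) \<Rightarrow> bool" where
  "rational_on S \<Phi> \<longleftrightarrow>
     (\<forall>i j. \<exists>p q. polynomial_fun p \<and> polynomial_fun q \<and>
        (\<forall>u\<in>S. q u \<noteq> 0 \<and> \<Phi> u $ i $ j = p u / q u))"

definition diagonalizable :: "complex^'n^'n \<Rightarrow> bool" where
  "diagonalizable A \<longleftrightarrow> (\<exists>(P :: complex^'n^'n) d.
     invertible P \<and> A = P ** diag_mat d ** matrix_inv P)"

definition char_poly :: "complex^'n^'n \<Rightarrow> complex poly" where
  "char_poly A = det (\<chi> i j. if i = j then [:- (A $ i $ j), 1:] else [:- (A $ i $ j):])"

definition eigenvalue_multiplicity :: "complex^'n^'n \<Rightarrow> complex \<Rightarrow> nat" where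
  "eigenvalue_multiplicity A c = order c (char_poly A)"

definition eigenspace :: "complex^'n^'n \<Rightarrow> complex \<Rightarrow> (complex^'n) set" where
  "eigenspace A c = {v. A *v v = c *s v}"

text \<open>For diagonalizable \<open>A\<close>: the projection onto the eigenspace for \<open>c\<close> along the sum of all the
  other eigenspaces. It is the zero matrix if \<open>c\<close> is not an eigenvalue. Note that \<open>vec.span\<close> is
  the complex span.\<close>

definition is_spectral_projection :: "complex^'n^'n \<Rightarrow> complex \<Rightarrow> complex^'n^'n \<Rightarrow> bool" where
  "is_spectral_projection A c P \<longleftrightarrow>
     P ** P = P \<and>
     range (\<lambda>v. P *v v) = eigenspace A c \<and>
     {v. P *v v = 0} = vec.span (\<Union>d\<in>-{c}. eigenspace A d)"

definition Phi :: "complex^'m^'n \<Rightarrow> complex^'n^'m \<Rightarrow> complex^'n \<Rightarrow> complex^'n^'n" where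
  "Phi a b u = ad (diag_mat u) (a ** matrix_inv (b ** diag_mat u ** a) ** b)"

end

theory Submission
  imports Defs
begin

text \<open>
  Fix \<open>u\<close>, write \<open>U\<close> for the diagonal matrix of \<open>u\<close> and \<open>X = a (bUa)\<^sup>-\<^sup>1 b\<close>, so that
  \<open>\<Phi> = [U, X]\<close>. Everything follows from three properties of \<open>X\<close>. The hypothesis \<open>ba = 0\<close> gives
  \<open>X X = 0\<close> (\<open>outer_inverse_square\<close>), cancelling \<open>bUa\<close> against its inverse gives \<open>X U X = X\<close>
  (\<open>outer_inverse_diag_outer_inverse\<close>), and comparing the inverses at two points \<open>u\<close> and \<open>v\<close> gives
  \<open>X\<^sub>v - X\<^sub>u = X\<^sub>v (U - V) X\<^sub>u\<close> (\<open>outer_inverse_resolvent_identity\<close>).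

  \<^emph>\<open>Isomonodromy.\<close> Letting \<open>v\<close> tend to \<open>u\<close> along the \<open>k\<close>-th axis in the last identity yields
  \<open>\<partial>\<^sub>k X = - X E\<^sub>k X\<close>, hence \<open>\<partial>\<^sub>k \<Phi> = [E\<^sub>k, X] - [U, X E\<^sub>k X]\<close>. On the other side,
  \<open>[E\<^sub>k, [U, X]] = [U, [E\<^sub>k, X]]\<close> and \<open>[E\<^sub>k, X]\<close> has zero diagonal, so
  \<open>ad\<^sub>u\<^sup>-\<^sup>1 [E\<^sub>k, \<Phi>] = [E\<^sub>k, X]\<close>, and \<open>[[E\<^sub>k, X], [U, X]]\<close> expands to the same expression by the first
  two properties (\<open>ad_commutator_identity\<close>). Rationality is Cramer's rule for \<open>(bUa)\<^sup>-\<^sup>1\<close>.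

  \<^emph>\<open>Spectrum.\<close> The first two properties say that \<open>P = U X\<close> and \<open>Q = X U\<close> are idempotent with
  \<open>P Q = 0\<close>, and \<open>\<Phi> = P - Q\<close>. The product \<open>Q P\<close> need not vanish, but giving half of it to
  each side makes \<open>P - QP/2\<close>, \<open>Q - QP/2\<close> and \<open>I - P - Q + QP\<close> a resolution of the identity into
  eigenprojections for \<open>1\<close>, \<open>-1\<close> and \<open>0\<close> (\<open>idempotent_pair_splitting\<close>). The multiplicities are the traces of these
  projections (\<open>trace_spectral_projection\<close>): \<open>P\<close> and \<open>Q\<close> have trace \<open>m\<close> by cyclicity, and
  \<open>Q P\<close> has the trace of \<open>P Q = 0\<close>. The bound \<open>2m \<le> n\<close> then holds because \<open>n - 2m\<close> is itself
  a multiplicity.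
\<close>

section \<open>Matrix algebra\<close>

lemma matrix_diff_ldistrib: "A ** (B - C) = A ** B - A ** (C :: 'a::ring_1^'p^'n)"
  by (vector matrix_matrix_mult_def sum_subtractf right_diff_distrib)

lemma matrix_diff_rdistrib: "(A - B) ** C = A ** C - B ** (C :: 'a::ring_1^'p^'n)"
  by (vector matrix_matrix_mult_def sum_subtractf left_diff_distrib)

lemma matrix_add_rdistrib: "(A + B) ** C = A ** C + B ** (C :: 'a::semiring_1^'p^'n)"
  by (vector matrix_matrix_mult_def sum.distrib distrib_right)

lemma matrix_mult_minus: "(- A) ** B = - (A ** (B :: 'a::ring_1^'p^'n))" "A ** (- B) = - (A ** B)"
  by (simp_all add: matrix_matrix_mult_def vec_eq_iff sum_negf)

lemma matrix_mult_zero [simp]: "A ** 0 = 0" "0 ** A = (0 :: 'a::ring_1^'p^'m)"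
  by (simp_all add: matrix_matrix_mult_def vec_eq_iff)

lemma matrix_inv_mult:
  assumes "invertible A"
  shows "A ** matrix_inv A = mat 1" "matrix_inv A ** A = mat 1"
  using someI_ex[OF assms[unfolded invertible_def]] unfolding matrix_inv_def by auto

lemma diag_mat_mult_nth:
  fixes A :: "'a::comm_ring_1^'p^'n"
  shows "(diag_mat d ** A) $ i $ j = d $ i * A $ i $ j"
  by (simp add: diag_mat_def matrix_matrix_mult_def if_distrib[of "\<lambda>x. x * _"] cong: if_cong)

lemma mult_diag_mat_nth:
  fixes A :: "'a::comm_ring_1^'n^'p"
  shows "(A ** diag_mat d) $ i $ j = A $ i $ j * d $ j"
  by (simp add: diag_mat_def matrix_matrix_mult_def if_distrib[of "\<lambda>x. _ * x"] cong: if_cong)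

lemma ad_diag_mat_nth:
  fixes A :: "'a::comm_ring_1^'n^'n"
  shows "ad (diag_mat d) A $ i $ j = (d $ i - d $ j) * A $ i $ j"
  by (simp add: ad_def diag_mat_mult_nth mult_diag_mat_nth algebra_simps)

lemma trace_scaleR: "trace (r *\<^sub>R A) = r *\<^sub>R trace (A :: complex^'n^'n)"
  by (simp add: trace_def scaleR_sum_right)

section \<open>Rank of one-sided invertible matrices\<close>

lemma rank_eq_if_left_inverse:
  fixes A :: "'a::field^'n^'m"
  assumes "B ** A = mat 1"
  shows "rank A = CARD('n)"
proof -
  have "vec.span (rows A) = UNIV"
    using assms matrix_left_invertible_span_rows_gen by blast
  then show ?thesis
    by (metis row_rank_def_gen vec.dim_span vec_dim_card)
qed

text \<open>The transpose of a right inverse maps the rows onto the standard basis, so their span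
  cannot have a smaller dimension.\<close>

lemma rank_eq_if_right_inverse:
  fixes A :: "'a::field^'n^'m"
  assumes "A ** B = mat 1"
  shows "rank A = CARD('m)"
proof (rule antisym)
  have rows: "rows A = range (\<lambda>i. row i A)"
    by (auto simp: rows_def)
  then have fin: "finite (rows A)"
    by simp
  from rows have "card (rows A) \<le> CARD('m)"
    by (simp add: card_image_le)
  then show "rank A \<le> CARD('m)"
    unfolding row_rank_def_gen using vec.dim_le_card'[OF fin] by linarith
  have "(transpose B) *v row i A = axis i 1" for i
  proof -
    have "(transpose B *v row i A) $ j = (A ** B) $ i $ j" for j
      by (simp add: row_def matrix_vector_mult_def transpose_def matrix_matrix_mult_def mult.commute)
    then show ?thesis
      by (simp add: assms vec_eq_iff mat_def axis_def eq_commute)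
  qed
  then have "(cart_basis :: ('a^'m) set) \<subseteq> (*v) (transpose B) ` rows A"
    by (auto simp: cart_basis_def rows_def image_iff) metis
  then have "vec.dim (cart_basis :: ('a^'m) set) \<le> vec.dim ((*v) (transpose B) ` rows A)"
    by (rule vec.dim_subset)
  also have "\<dots> \<le> vec.dim (rows A)"
    by (rule vec.dim_image_le[OF matrix_vector_mul_linear_gen])
  finally show "CARD('m) \<le> rank A"
    using vec.dim_span[of "cart_basis :: ('a^'m) set"]
    by (simp add: row_rank_def_gen span_cart_basis vec_dim_card card_cart_basis)
qed

section \<open>Diagonalizable matrices and spectral projections\<close>

text \<open>A spanning set of eigenvectors contains a basis, whose vectors serve as the columns of the
  diagonalizing matrix.\<close>

lemma diagonalizable_if_eigenspaces_span:
  assumes span: "vec.span (\<Union>c. eigenspace A c) = UNIV"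
  shows "diagonalizable (A :: complex^'n^'n)"
proof -
  obtain B where B: "B \<subseteq> (\<Union>c. eigenspace A c)" "vec.independent B"
      "(\<Union>c. eigenspace A c) \<subseteq> vec.span B"
    using vec.maximal_independent_subset by blast
  have spanB: "vec.span B = UNIV"
    using span vec.span_mono[OF B(3)] by (simp add: vec.span_span top.extremum_unique)
  have finB: "finite B"
    using B(2) by (rule vec.finiteI_independent)
  have "card B = CARD('n)"
    using vec.basis_card_eq_dim[of B UNIV] B(2) spanB vec_dim_card[where 'n='n and 'a=complex] by simp
  then obtain f where f: "bij_betw f (UNIV :: 'n set) B"
    using finite_same_card_bij[of "UNIV :: 'n set" B] finB by auto
  have "\<forall>i. \<exists>c. A *v f i = c *s f i"
    using f B(1) unfolding bij_betw_def eigenspace_def by blast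
  then obtain d where d: "\<And>i. A *v f i = d i *s f i"
    by metis
  define S :: "complex^'n^'n" where "S = (\<chi> i j. f j $ i)"
  have col: "column j S = f j" for j
    by (simp add: S_def column_def)
  have "columns S = B"
    using f by (auto simp: columns_def col bij_betw_def)
  then have inv: "invertible S"
    using matrix_right_invertible_span_columns[of S] spanB
    by (simp add: invertible_right_inverse)
  have "A ** S = S ** diag_mat (\<chi> i. d i)"
  proof -
    have "(A ** S) $ i $ j = (A *v f j) $ i" for i j
      by (simp add: S_def matrix_matrix_mult_def matrix_vector_mult_def)
    then show ?thesis
      by (simp add: vec_eq_iff d mult_diag_mat_nth S_def mult.commute)
  qed
  then have "A = S ** diag_mat (\<chi> i. d i) ** matrix_inv S"
    by (metis inv matrix_inv_mult(1) matrix_mul_assoc matrix_mul_rid)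
  with inv show ?thesis
    unfolding diagonalizable_def by blast
qed

text \<open>
  A family of matrices \<open>P c\<close> that sums to the identity, with \<open>A P c = P c A = c P c\<close>, splits every
  vector into eigenvectors. Since \<open>P c\<close> commutes with \<open>A\<close>, it kills the eigenspaces for the other
  eigenvalues, and what remains of the decomposition of an eigenvector for \<open>c\<close> says that \<open>P c\<close>
  fixes it.
\<close>

context
  fixes A :: "complex^'n^'n" and S :: "complex set" and P :: "complex \<Rightarrow> complex^'n^'n"
  assumes finite: "finite S"
    and resolution: "\<And>v. (\<Sum>c\<in>S. P c *v v) = v"
    and left: "\<And>c v. c \<in> S \<Longrightarrow> A *v (P c *v v) = c *s (P c *v v)"
    and right: "\<And>c v. c \<in> S \<Longrightarrow> P c *v (A *v v) = c *s (P c *v v)"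
begin

lemma resolution_range: "c \<in> S \<Longrightarrow> P c *v v \<in> eigenspace A c"
  by (simp add: eigenspace_def left)

lemma resolution_other_eigenspace:
  assumes "c \<in> S" "v \<in> eigenspace A d" "d \<noteq> c"
  shows "P c *v v = 0"
proof -
  have "d *s (P c *v v) = c *s (P c *v v)"
    using right[OF assms(1), of v] assms(2) unfolding eigenspace_def by (simp add: vector_scalar_commute)
  then show ?thesis
    using assms(3) by simp
qed

lemma resolution_own_eigenspace:
  assumes "c \<in> S" "v \<in> eigenspace A c"
  shows "P c *v v = v"
proof -
  have "(\<Sum>d\<in>S. P d *v v) = (\<Sum>d\<in>{c}. P d *v v)"
    by (rule sum.mono_neutral_right)
      (use assms finite in \<open>auto intro: resolution_other_eigenspace\<close>)
  then show ?thesis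
    by (simp add: resolution)
qed

lemma resolution_diagonalizable: "diagonalizable A"
proof (rule diagonalizable_if_eigenspaces_span)
  have "v \<in> vec.span (\<Union>c. eigenspace A c)" for v
    using vec.span_sum[of S "\<lambda>c. P c *v v" "\<Union>c. eigenspace A c"] resolution_range
    by (auto simp: resolution intro: vec.span_base)
  then show "vec.span (\<Union>c. eigenspace A c) = UNIV"
    by blast
qed

lemma resolution_spectral_projection:
  assumes c: "c \<in> S"
  shows "is_spectral_projection A c (P c)"
  unfolding is_spectral_projection_def
proof (intro conjI)
  show "P c ** P c = P c"
    unfolding matrix_eq
    by (simp add: matrix_vector_mul_assoc[symmetric] resolution_own_eigenspace c resolution_range)
  show "range ((*v) (P c)) = eigenspace A c"
  proof (intro set_eqI iffI)
    fix v
    assume "v \<in> eigenspace A c"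
    then show "v \<in> range ((*v) (P c))"
      by (intro range_eqI[of _ _ v]) (simp add: resolution_own_eigenspace[OF c])
  qed (use resolution_range[OF c] in blast)
  have "vec.subspace {v. P c *v v = 0}"
    by (auto simp: vec.subspace_def matrix_vector_right_distrib vector_scalar_commute)
  moreover have "(\<Union>d\<in>-{c}. eigenspace A d) \<subseteq> {v. P c *v v = 0}"
    using resolution_other_eigenspace c by auto
  ultimately have "vec.span (\<Union>d\<in>-{c}. eigenspace A d) \<subseteq> {v. P c *v v = 0}"
    by (rule vec.span_minimal[rotated])
  moreover have "v \<in> vec.span (\<Union>d\<in>-{c}. eigenspace A d)" if "P c *v v = 0" for v
  proof -
    have "v = (\<Sum>d\<in>S - {c}. P d *v v)"
      using resolution[of v] sum.remove[OF finite c, of "\<lambda>d. P d *v v"] that by simp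
    also have "\<dots> \<in> vec.span (\<Union>d\<in>-{c}. eigenspace A d)"
      by (intro vec.span_sum vec.span_base) (use resolution_range in blast)
    finally show ?thesis .
  qed
  ultimately show "{v. P c *v v = 0} = vec.span (\<Union>d\<in>-{c}. eigenspace A d)"
    by blast
qed

end

lemma poly_char_poly: "poly (char_poly A) x = det (mat x - A)"
proof -
  have "poly (char_poly A) x =
      (\<Sum>p | p permutes UNIV. of_int (sign p) * (\<Prod>i\<in>UNIV. (mat x - A) $ i $ p i))"
    unfolding char_poly_def det_def
    by (auto simp: poly_sum poly_prod mat_def intro!: sum.cong prod.cong)
  then show ?thesis
    by (simp add: det_def)
qed

text \<open>Both sides are compared as functions of the indeterminate, because similarity by \<open>S\<close> lives over
  the complex numbers and not over the polynomial ring in which \<open>char_poly\<close> takes its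
  determinant.\<close>

lemma char_poly_diagonalized:
  fixes A S :: "complex^'n^'n"
  assumes S: "invertible S" and A: "A = S ** diag_mat d ** matrix_inv S"
  shows "char_poly A = (\<Prod>i\<in>UNIV. [:- (d $ i), 1:])"
proof -
  have "poly (char_poly A) x = (\<Prod>i\<in>UNIV. x - d $ i)" for x
  proof -
    have "mat x = S ** mat x ** matrix_inv S"
    proof -
      have "S ** mat x = mat x ** S"
        by (simp add: vec_eq_iff matrix_matrix_mult_def mat_def
            if_distrib[of "\<lambda>y. y * _"] if_distrib[of "\<lambda>y. _ * y"] mult.commute cong: if_cong)
      then show ?thesis
        using S by (metis matrix_inv_mult(1) matrix_mul_assoc matrix_mul_rid)
    qed
    then have "mat x - A = S ** (mat x - diag_mat d) ** matrix_inv S"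
      using A by (simp add: matrix_diff_ldistrib matrix_diff_rdistrib)
    moreover have "det S * det (matrix_inv S) = 1"
      using matrix_inv_mult(1)[OF S] by (metis det_I det_mul)
    ultimately have "det (mat x - A) = det (mat x - diag_mat d)"
      by (simp add: det_mul)
    also have "\<dots> = (\<Prod>i\<in>UNIV. x - d $ i)"
      by (subst det_diagonal) (simp_all add: mat_def diag_mat_def)
    finally show ?thesis
      by (simp add: poly_char_poly)
  qed
  then show ?thesis
    by (simp add: poly_eq_poly_eq_iff[symmetric] fun_eq_iff poly_prod)
qed

lemma order_prod_linear:
  fixes c :: "'a::idom"
  assumes "finite I"
  shows "order c (\<Prod>i\<in>I. [:- f i, 1:]) = card {i \<in> I. f i = c}"
  using assms
proof (induction I)
  case empty
  then show ?case by simp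
next
  case (insert i I)
  have one: "order c [:- f i, 1:] = (if f i = c then 1 else 0)"
    using order_power_n_n[of c 1] by (auto intro: order_0I)
  have set: "{j \<in> insert i I. f j = c} = (if f i = c then insert i {j \<in> I. f j = c} else {j \<in> I. f j = c})"
    by auto
  have "order c (\<Prod>i\<in>insert i I. [:- f i, 1:]) = order c [:- f i, 1:] + order c (\<Prod>i\<in>I. [:- f i, 1:])"
    using insert by (simp add: order_mult prod_zero_iff del: mult_pCons_left)
  then show ?case
    using insert one set by simp
qed

text \<open>In a basis of eigenvectors the spectral projection for \<open>c\<close> is the diagonal 0-1 matrix that
  marks the occurrences of \<open>c\<close> on the diagonal of the diagonalized \<open>A\<close>; these occurrences are also counted by the order
  of \<open>c\<close> in the characteristic polynomial.\<close>

lemma trace_spectral_projection: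
  fixes A P :: "complex^'n^'n"
  assumes A: "diagonalizable A" and P: "is_spectral_projection A c P"
  shows "trace P = of_nat (eigenvalue_multiplicity A c)"
proof -
  obtain S :: "complex^'n^'n" and d where S: "invertible S" and AS: "A = S ** diag_mat d ** matrix_inv S"
    using A unfolding diagonalizable_def by blast
  have idem: "P *v (P *v v) = P *v v" for v
    using P by (simp add: is_spectral_projection_def matrix_vector_mul_assoc)
  define D :: "complex^'n^'n" where "D = diag_mat (\<chi> i. if d $ i = c then 1 else 0)"
  have "A ** S = S ** diag_mat d"
    by (simp add: AS matrix_mul_assoc[symmetric] matrix_inv_mult S)
  then have "(A ** S) $ i $ j = S $ i $ j * d $ j" for i j
    by (simp add: mult_diag_mat_nth)
  moreover have mult_column: "(B ** S) $ i $ j = (B *v column j S) $ i" for B :: "complex^'n^'n" and i j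
    by (simp add: matrix_matrix_mult_def matrix_vector_mult_def column_def)
  ultimately have eig: "column j S \<in> eigenspace A (d $ j)" for j
    by (simp add: eigenspace_def vec_eq_iff column_def mult.commute)
  have "P *v column j S = (if d $ j = c then column j S else 0)" for j
  proof (cases "d $ j = c")
    case True
    then have "column j S \<in> range ((*v) P)"
      using P eig[of j] by (simp add: is_spectral_projection_def)
    with True idem show ?thesis
      by auto
  next
    case False
    then have "column j S \<in> {v. P *v v = 0}"
      using P eig[of j] by (auto simp: is_spectral_projection_def intro: vec.span_base)
    with False show ?thesis by simp
  qed
  then have "P ** S = S ** D"
    by (simp add: mult_column vec_eq_iff D_def mult_diag_mat_nth column_def)
  then have "P = S ** D ** matrix_inv S"
    by (metis S matrix_inv_mult(1) matrix_mul_assoc matrix_mul_rid)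
  then have "trace P = trace (matrix_inv S ** (S ** D))"
    using trace_mul_sym[of "S ** D" "matrix_inv S"] by simp
  also have "\<dots> = trace D"
    by (simp add: matrix_mul_assoc matrix_inv_mult S)
  also have "\<dots> = of_nat (card {i. d $ i = c})"
    by (simp add: trace_def D_def diag_mat_def sum.If_cases)
  also have "\<dots> = of_nat (eigenvalue_multiplicity A c)"
    using order_prod_linear[of "UNIV :: 'n set" c "\<lambda>i. d $ i"]
    by (simp add: eigenvalue_multiplicity_def char_poly_diagonalized[OF S AS])
  finally show ?thesis .
qed

text \<open>Subtracting the same multiple \<open>t Q P\<close> from \<open>P\<close> and from \<open>Q\<close> leaves the difference \<open>P - Q\<close> and
  both idempotences intact. One half is the multiple that makes the two projections annihilate each
  other: \<open>(P - t Q P) (Q - t Q P) = 0\<close> for every \<open>t\<close>, but \<open>(Q - t Q P) (P - t Q P) = (1 - 2 t) Q P\<close>.\<close>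

lemma idempotent_pair_splitting:
  fixes P Q :: "complex^'n^'n"
  assumes P: "P ** P = P" and Q: "Q ** Q = Q" and PQ: "P ** Q = 0"
  defines "A \<equiv> P - Q" and "P1 \<equiv> P - (1/2) *\<^sub>R (Q ** P)" and "Pm1 \<equiv> Q - (1/2) *\<^sub>R (Q ** P)"
    and "P0 \<equiv> mat 1 - P - Q + Q ** P"
  shows "diagonalizable A" "is_spectral_projection A 1 P1" "is_spectral_projection A (-1) Pm1"
    "is_spectral_projection A 0 P0"
proof -
  define H where "H = (1/2) *\<^sub>R (Q ** P)"
  have QP: "Q ** P = H + H"
    by (simp add: H_def flip: scaleR_add_left)
  have "Q ** P ** P = Q ** P" "Q ** (Q ** P) = Q ** P" "P ** (Q ** P) = 0" "Q ** P ** Q = 0"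
    by (metis P matrix_mul_assoc, metis Q matrix_mul_assoc,
        metis PQ matrix_mul_assoc matrix_mult_zero(2), metis PQ matrix_mul_assoc matrix_mult_zero(1))
  then have H: "H ** P = H" "Q ** H = H" "P ** H = 0" "H ** Q = 0"
    by (simp_all add: H_def matrix_scalar_ac flip: scalar_matrix_assoc)
  note expand = A_def P1_def Pm1_def P0_def H_def[symmetric] QP matrix_add_ldistrib
    matrix_add_rdistrib matrix_diff_ldistrib matrix_diff_rdistrib P Q PQ H
  have sum: "P1 + Pm1 + P0 = mat 1"
    by (simp add: expand)
  then have P0: "P0 = mat 1 - P1 - Pm1"
    by (simp add: algebra_simps)
  have eigen1: "A ** P1 = P1" "P1 ** A = P1" "A ** Pm1 = - Pm1" "Pm1 ** A = - Pm1"
    by (simp_all add: expand)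
  have A: "P1 - Pm1 = A"
    by (simp add: A_def P1_def Pm1_def)
  have "A ** P0 = A - (P1 - Pm1)" "P0 ** A = A - (P1 - Pm1)"
    by (simp_all add: P0 matrix_diff_ldistrib matrix_diff_rdistrib eigen1)
  then have "A ** P0 = 0" "P0 ** A = 0"
    by (simp_all add: A)
  note eigen = eigen1 this
  define F where "F = (\<lambda>c::complex. if c = 1 then P1 else if c = -1 then Pm1 else P0)"
  have F: "F 1 = P1" "F (-1) = Pm1" "F 0 = P0"
    by (simp_all add: F_def)
  have resolution: "(\<Sum>c\<in>{1, -1, 0}. F c *v v) = v" for v
  proof -
    have "(\<Sum>c\<in>{1, -1, 0}. F c *v v) = (P1 + Pm1 + P0) *v v"
      by (simp add: F matrix_vector_mult_add_rdistrib add.assoc)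
    then show ?thesis
      by (simp add: sum)
  qed
  have neg: "(- B) *v v = (-1) *s (B *v v)" for B :: "complex^'n^'n" and v
    by (simp add: vec_eq_iff matrix_vector_mult_def sum_negf)
  have left: "A *v (F c *v v) = c *s (F c *v v)" if "c \<in> {1, -1, 0}" for c v
    using that by (auto simp: F matrix_vector_mul_assoc eigen neg)
  have right: "F c *v (A *v v) = c *s (F c *v v)" if "c \<in> {1, -1, 0}" for c v
    using that by (auto simp: F matrix_vector_mul_assoc eigen neg)
  note family = _ resolution left right
  show "diagonalizable A"
    by (rule resolution_diagonalizable[OF family]) auto
  show "is_spectral_projection A 1 P1" "is_spectral_projection A (-1) Pm1"
      "is_spectral_projection A 0 P0"
    using resolution_spectral_projection[OF family, of 1] resolution_spectral_projection[OF family, of "-1"]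
      resolution_spectral_projection[OF family, of 0] by (simp_all add: F)
qed

section \<open>Rational functions of the diagonal entries\<close>

lemma polynomial_fun_sum:
  "finite I \<Longrightarrow> (\<And>i. i \<in> I \<Longrightarrow> polynomial_fun (f i)) \<Longrightarrow> polynomial_fun (\<lambda>u. \<Sum>i\<in>I. f i u)"
  by (induction I rule: finite_induct) (auto intro: polynomial_fun.intros)

lemma polynomial_fun_prod:
  "finite I \<Longrightarrow> (\<And>i. i \<in> I \<Longrightarrow> polynomial_fun (f i)) \<Longrightarrow> polynomial_fun (\<lambda>u. \<Prod>i\<in>I. f i u)"
  by (induction I rule: finite_induct) (auto intro: polynomial_fun.intros)

lemma polynomial_fun_det:
  fixes F :: "complex^'n \<Rightarrow> complex^'m^'m"
  assumes "\<And>i j. polynomial_fun (\<lambda>u. F u $ i $ j)"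
  shows "polynomial_fun (\<lambda>u. det (F u))"
  unfolding det_def
  by (intro polynomial_fun_sum polynomial_fun.mult polynomial_fun.const polynomial_fun_prod assms)
    (auto intro: finite_permutations)

lemma polynomial_fun_continuous:
  assumes "polynomial_fun p"
  shows "continuous_on UNIV p"
  using assms by induction (auto intro!: continuous_intros)

lemma polynomial_fun_matrix_mult:
  fixes F :: "complex^'n \<Rightarrow> complex^'m^'l" and G :: "complex^'n \<Rightarrow> complex^'k^'m"
  assumes "\<And>i j. polynomial_fun (\<lambda>u. F u $ i $ j)" "\<And>i j. polynomial_fun (\<lambda>u. G u $ i $ j)"
  shows "polynomial_fun (\<lambda>u. (F u ** G u) $ i $ j)"
  by (simp add: matrix_matrix_mult_def polynomial_fun_sum polynomial_fun.mult assms)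

lemma polynomial_fun_sandwich:
  fixes a :: "complex^'m^'n" and b :: "complex^'n^'m"
  shows "polynomial_fun (\<lambda>u. (b ** diag_mat u ** a) $ i $ j)"
  by (simp add: matrix_matrix_mult_def[of _ a] mult_diag_mat_nth polynomial_fun_sum
      polynomial_fun.mult polynomial_fun.const polynomial_fun.coord)

text \<open>The entry at \<open>(i, j)\<close> is the numerator that Cramer's rule gives for the \<open>i\<close>-th unknown when the
  right-hand side is the \<open>j\<close>-th unit vector.\<close>

definition adjugate :: "'a::comm_ring_1^'n^'n \<Rightarrow> 'a^'n^'n" where
  "adjugate A = (\<chi> i j. det (\<chi> r s. if s = i then axis j 1 $ r else A $ r $ s))"

lemma matrix_inv_adjugate:
  fixes A :: "'a::field^'n^'n"
  assumes "invertible A"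
  shows "matrix_inv A $ i $ j = adjugate A $ i $ j / det A"
proof -
  have "A *v column j (matrix_inv A) = axis j 1"
  proof -
    have "(A *v column j (matrix_inv A)) $ i = (A ** matrix_inv A) $ i $ j" for i
      by (simp add: matrix_vector_mult_def column_def matrix_matrix_mult_def)
    then show ?thesis
      by (simp add: matrix_inv_mult assms vec_eq_iff mat_def axis_def)
  qed
  then have "column j (matrix_inv A) $ i = adjugate A $ i $ j / det A"
    using cramer[of A] assms by (simp add: invertible_det_nz adjugate_def)
  then show ?thesis
    by (simp add: column_def)
qed

lemma polynomial_fun_adjugate:
  fixes F :: "complex^'n \<Rightarrow> complex^'m^'m"
  assumes "\<And>i j. polynomial_fun (\<lambda>u. F u $ i $ j)"
  shows "polynomial_fun (\<lambda>u. adjugate (F u) $ i $ j)"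
proof -
  have "polynomial_fun (\<lambda>u. (\<chi> r s. if s = i then axis j 1 $ r else F u $ r $ s) $ r $ s)" for r s
    by (cases "s = i") (simp_all add: polynomial_fun.const assms)
  then show ?thesis
    by (simp add: adjugate_def polynomial_fun_det)
qed

lemma rational_on_ad_diag:
  assumes "rational_on S F"
  shows "rational_on S (\<lambda>u. ad (diag_mat u) (F u))"
  unfolding rational_on_def
proof (intro allI)
  fix i j
  obtain p q where pq: "polynomial_fun p" "polynomial_fun q"
      "\<And>u. u \<in> S \<Longrightarrow> q u \<noteq> 0 \<and> F u $ i $ j = p u / q u"
    using assms unfolding rational_on_def by metis
  have "polynomial_fun (\<lambda>u. (u $ i + (-1) * u $ j) * p u)"
    by (intro polynomial_fun.intros pq)
  with pq show "\<exists>p q. polynomial_fun p \<and> polynomial_fun q \<and>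
      (\<forall>u\<in>S. q u \<noteq> 0 \<and> ad (diag_mat u) (F u) $ i $ j = p u / q u)"
    by (intro exI[of _ "\<lambda>u. (u $ i + (-1) * u $ j) * p u"] exI[of _ q])
      (simp add: ad_diag_mat_nth)
qed

lemma rational_on_continuous:
  assumes "rational_on S F"
  shows "continuous_on S (\<lambda>u. F u $ i $ j)"
proof -
  obtain p q where pq: "polynomial_fun p" "polynomial_fun q"
      "\<And>u. u \<in> S \<Longrightarrow> q u \<noteq> 0 \<and> F u $ i $ j = p u / q u"
    using assms unfolding rational_on_def by metis
  have "continuous_on S (\<lambda>u. p u / q u)"
    by (rule continuous_on_divide)
      (use pq in \<open>auto intro: continuous_on_subset[OF polynomial_fun_continuous]\<close>)
  then show ?thesis
    using pq by (simp cong: continuous_on_cong)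
qed

section \<open>The matrix whose commutator with u is the solution\<close>

text \<open>In the language of generalized inverses: where \<open>bua\<close> is invertible, this is the outer inverse of
  \<open>diag_mat u\<close> (an \<open>X\<close> with \<open>X u X = X\<close>) whose range is that of \<open>a\<close> and whose kernel is that of
  \<open>b\<close>.\<close>

definition outer_inverse :: "complex^'m^'n \<Rightarrow> complex^'n^'m \<Rightarrow> complex^'n \<Rightarrow> complex^'n^'n" where
  "outer_inverse a b u = a ** matrix_inv (b ** diag_mat u ** a) ** b"

lemma Phi_eq_ad_outer_inverse: "Phi a b u = ad (diag_mat u) (outer_inverse a b u)"
  by (simp add: Phi_def outer_inverse_def)

definition regular_points :: "complex^'m^'n \<Rightarrow> complex^'n^'m \<Rightarrow> (complex^'n) set" where
  "regular_points a b = {u. invertible (b ** diag_mat u ** a)}"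

lemma rational_on_outer_inverse: "rational_on (regular_points a b) (outer_inverse a b)"
  unfolding rational_on_def
proof (intro allI exI conjI ballI)
  fix i j
  let ?W = "\<lambda>u. b ** diag_mat u ** a"
  show "polynomial_fun (\<lambda>u. (a ** adjugate (?W u) ** b) $ i $ j)"
    by (intro polynomial_fun_matrix_mult polynomial_fun_adjugate polynomial_fun_sandwich
        polynomial_fun.const)
  show "polynomial_fun (\<lambda>u. det (?W u))"
    by (intro polynomial_fun_det polynomial_fun_sandwich)
  fix u
  assume "u \<in> regular_points a b"
  then have inv: "invertible (?W u)"
    by (simp add: regular_points_def)
  then show "det (?W u) \<noteq> 0"
    by (simp add: invertible_det_nz)
  show "outer_inverse a b u $ i $ j = (a ** adjugate (?W u) ** b) $ i $ j / det (?W u)"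
    by (simp add: outer_inverse_def matrix_matrix_mult_def[of _ b] matrix_matrix_mult_def[of a]
        matrix_inv_adjugate[OF inv] sum_divide_distrib sum_distrib_right)
qed

lemma open_regular_points: "open (regular_points a b)"
proof -
  have "continuous_on UNIV (\<lambda>u. det (b ** diag_mat u ** a))"
    by (intro polynomial_fun_continuous polynomial_fun_det polynomial_fun_sandwich)
  then have "open {u. det (b ** diag_mat u ** a) \<noteq> 0}"
    by (intro open_Collect_neq continuous_on_const)
  then show ?thesis
    by (simp add: regular_points_def invertible_det_nz)
qed

lemma outer_inverse_square:
  assumes "b ** a = 0"
  shows "outer_inverse a b u ** outer_inverse a b u = 0"
proof -
  have "outer_inverse a b u ** outer_inverse a b u =
      a ** matrix_inv (b ** diag_mat u ** a) ** (b ** a) ** matrix_inv (b ** diag_mat u ** a) ** b"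
    by (simp add: outer_inverse_def matrix_mul_assoc)
  then show ?thesis
    by (simp add: assms)
qed

lemma outer_inverse_diag_outer_inverse:
  assumes "u \<in> regular_points a b"
  shows "outer_inverse a b u ** diag_mat u ** outer_inverse a b u = outer_inverse a b u"
proof -
  let ?W = "b ** diag_mat u ** a"
  have "outer_inverse a b u ** diag_mat u ** outer_inverse a b u = a ** (matrix_inv ?W ** ?W) ** matrix_inv ?W ** b"
    by (simp add: outer_inverse_def matrix_mul_assoc)
  then show ?thesis
    using assms by (simp add: regular_points_def matrix_inv_mult outer_inverse_def)
qed

text \<open>This is \<open>V\<^sup>-\<^sup>1 - W\<^sup>-\<^sup>1 = V\<^sup>-\<^sup>1 (W - V) W\<^sup>-\<^sup>1\<close> with \<open>V = bva\<close> and \<open>W = bua\<close>, multiplied by \<open>a\<close> and \<open>b\<close>. It turns the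
  difference quotients of the outer inverse into products of its values, so that its continuity
  already yields its partial derivatives.\<close>

lemma outer_inverse_resolvent_identity:
  assumes u: "u \<in> regular_points a b" and v: "v \<in> regular_points a b"
  shows "outer_inverse a b v - outer_inverse a b u = outer_inverse a b v ** diag_mat (u - v) ** outer_inverse a b u"
proof -
  let ?W = "\<lambda>u. b ** diag_mat u ** a"
  have diag: "diag_mat (u - v) = diag_mat u - diag_mat v"
    by (simp add: diag_mat_def vec_eq_iff)
  have "outer_inverse a b v ** diag_mat (u - v) ** outer_inverse a b u =
      a ** (matrix_inv (?W v) ** (?W u - ?W v) ** matrix_inv (?W u)) ** b"
    by (simp add: outer_inverse_def diag matrix_mul_assoc matrix_diff_ldistrib matrix_diff_rdistrib)
  also have "matrix_inv (?W v) ** (?W u - ?W v) ** matrix_inv (?W u) =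
      matrix_inv (?W v) ** (?W u ** matrix_inv (?W u)) -
      (matrix_inv (?W v) ** ?W v) ** matrix_inv (?W u)"
    by (simp only: matrix_mul_assoc matrix_diff_ldistrib matrix_diff_rdistrib)
  also have "\<dots> = matrix_inv (?W v) - matrix_inv (?W u)"
    using u v by (simp add: regular_points_def matrix_inv_mult)
  finally show ?thesis
    by (simp add: outer_inverse_def matrix_diff_ldistrib matrix_diff_rdistrib)
qed

lemma outer_inverse_partial_derivative:
  assumes u: "u \<in> regular_points a b"
  shows "((\<lambda>z. outer_inverse a b (\<chi> l. if l = k then z else u $ l) $ i $ j) has_field_derivative
      - (outer_inverse a b u $ i $ k * outer_inverse a b u $ k $ j)) (at (u $ k))"
proof -
  define line where "line z = (\<chi> l. if l = k then z else u $ l)" for z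
  have line_base: "line (u $ k) = u"
    by (simp add: line_def vec_eq_iff)
  have line_coord: "line z $ k = z" for z
    by (simp add: line_def)
  have line: "(line \<longlongrightarrow> u) (at (u $ k))"
    unfolding line_def
  proof (rule vec_tendstoI)
    fix l
    show "((\<lambda>z. (\<chi> l. if l = k then z else u $ l) $ l) \<longlongrightarrow> u $ l) (at (u $ k))"
      by (cases "l = k") auto
  qed
  have near: "\<forall>\<^sub>F z in at (u $ k). line z \<in> regular_points a b"
    using topological_tendstoD[OF line open_regular_points u] .
  \<comment> \<open>By the resolvent identity the difference quotient of the \<open>(i, j)\<close> entry is minus the product of the
    \<open>(i, k)\<close> entry at the moving point and the \<open>(k, j)\<close> entry at \<open>u\<close>.\<close>
  have "isCont (\<lambda>v. outer_inverse a b v $ i $ k) u"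
    using rational_on_continuous[OF rational_on_outer_inverse] open_regular_points u
    by (metis continuous_on_eq_continuous_at)
  then have "((\<lambda>z. outer_inverse a b (line z) $ i $ k) \<longlongrightarrow> outer_inverse a b u $ i $ k) (at (u $ k))"
    using line by (rule isCont_tendsto_compose)
  then have "((\<lambda>z. - (outer_inverse a b (line z) $ i $ k * outer_inverse a b u $ k $ j)) \<longlongrightarrow>
      - (outer_inverse a b u $ i $ k * outer_inverse a b u $ k $ j)) (at (u $ k))"
    by (intro tendsto_minus tendsto_mult tendsto_const)
  moreover have "\<forall>\<^sub>F z in at (u $ k). - (outer_inverse a b (line z) $ i $ k * outer_inverse a b u $ k $ j) =
      (outer_inverse a b (line z) $ i $ j - outer_inverse a b (line (u $ k)) $ i $ j) / (z - u $ k)"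
    using near eventually_neq_at_within[of "u $ k" "u $ k"]
  proof eventually_elim
    case (elim z)
    have "outer_inverse a b (line z) $ i $ j - outer_inverse a b u $ i $ j =
        (outer_inverse a b (line z) ** diag_mat (u - line z) ** outer_inverse a b u) $ i $ j"
      using outer_inverse_resolvent_identity[OF u elim(1)] by (metis vector_minus_component)
    also have "\<dots> = (\<Sum>l\<in>UNIV. outer_inverse a b (line z) $ i $ l * (u $ l - line z $ l) * outer_inverse a b u $ l $ j)"
      by (simp add: matrix_matrix_mult_def[of "_ ** _"] mult_diag_mat_nth)
    also have "\<dots> = (\<Sum>l\<in>{k}. outer_inverse a b (line z) $ i $ l * (u $ l - line z $ l) * outer_inverse a b u $ l $ j)"
      by (rule sum.mono_neutral_right) (auto simp: line_def)
    finally show ?case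
      using elim(2) by (simp add: line_base line_coord field_simps)
  qed
  ultimately show ?thesis
    unfolding has_field_derivative_iff line_def[symmetric]
    by (rule Lim_transform_eventually)
qed

section \<open>The isomonodromy equation\<close>

text \<open>The two diagonal commutators commute with each other, and \<open>ad (diag_mat d) X\<close> has zero diagonal, which is
  where \<open>ad_inv u\<close> inverts \<open>ad (diag_mat u)\<close>.\<close>

lemma ad_inv_ad_ad_diag:
  assumes "inj (\<lambda>i. u $ i)"
  shows "ad_inv u (ad (diag_mat d) (ad (diag_mat u) X)) = ad (diag_mat d) X"
proof -
  have "u $ i - u $ j \<noteq> 0" if "i \<noteq> j" for i j
    using injD[OF assms, of i j] that by auto
  then show ?thesis
    by (simp add: vec_eq_iff ad_inv_def ad_diag_mat_nth)
qed

text \<open>With \<open>E = E\<^sub>k\<close> the two sides are the right-hand side of the isomonodromy equation and the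
  partial derivative of \<open>[U, X]\<close>. Of the eight products in the expansion, \<open>E X X U\<close> and \<open>U X X E\<close>
  vanish, \<open>E X U X\<close> and \<open>X U X E\<close> reduce to \<open>[E, X]\<close>, \<open>X E U X\<close> and \<open>X U E X\<close> cancel, and \<open>X E X U\<close>
  and \<open>U X E X\<close> form \<open>- [U, X E X]\<close>.\<close>

lemma ad_commutator_identity:
  fixes X U E :: "complex^'n^'n"
  assumes sq: "X ** X = 0" and XUX: "X ** U ** X = X" and com: "E ** U = U ** E"
  shows "ad (ad E X) (ad U X) = ad E X - ad U (X ** E ** X)"
proof -
  have rules: "Y ** X ** X = 0" "Y ** X ** U ** X = Y ** X" "Y ** U ** E = Y ** E ** U"
    for Y :: "complex^'n^'n"
    by (metis matrix_mul_assoc sq matrix_mult_zero(1), metis matrix_mul_assoc XUX,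
        metis matrix_mul_assoc com)
  show ?thesis
    by (simp add: ad_def matrix_diff_ldistrib matrix_diff_rdistrib matrix_mul_assoc rules sq XUX
        com matrix_mult_minus)
qed

lemma isomonodromy_solution_Phi:
  assumes "b ** a = 0"
  shows "isomonodromy_solution_on {u \<in> regular_points a b. inj (\<lambda>i. u $ i)} (Phi a b)"
  unfolding isomonodromy_solution_on_def
proof (intro ballI allI)
  fix u k i j
  assume "u \<in> {u \<in> regular_points a b. inj (\<lambda>i. u $ i)}"
  then have u: "u \<in> regular_points a b" and inj: "inj (\<lambda>i. u $ i)"
    by auto
  let ?X = "outer_inverse a b u"
  let ?line = "\<lambda>z. \<chi> l. if l = k then z else u $ l"
  have "(?X ** diag_unit k ** ?X) $ i $ j = ?X $ i $ k * ?X $ k $ j"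
    by (simp add: matrix_matrix_mult_def[of "_ ** _"] diag_unit_def mult_diag_mat_nth axis_def
        if_distrib[of "\<lambda>y. _ * y"] if_distrib[of "\<lambda>y. y * _"] cong: if_cong)
  moreover have "diag_unit k ** diag_mat u = diag_mat u ** diag_unit k"
    by (simp add: vec_eq_iff diag_unit_def mult_diag_mat_nth diag_mat_mult_nth)
      (simp add: diag_mat_def)
  ultimately have "ad (ad_inv u (ad (diag_unit k) (Phi a b u))) (Phi a b u) $ i $ j =
      (axis k 1 $ i - axis k 1 $ j) * ?X $ i $ j - (u $ i - u $ j) * (?X $ i $ k * ?X $ k $ j)"
    using ad_commutator_identity[OF outer_inverse_square[OF assms, of u] outer_inverse_diag_outer_inverse[OF u], of "diag_unit k"]
    by (simp add: Phi_eq_ad_outer_inverse diag_unit_def ad_inv_ad_ad_diag[OF inj] ad_diag_mat_nth)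
  moreover have "((\<lambda>z. (?line z $ i - ?line z $ j) * outer_inverse a b (?line z) $ i $ j) has_field_derivative
      (axis k 1 $ i - axis k 1 $ j) * ?X $ i $ j - (u $ i - u $ j) * (?X $ i $ k * ?X $ k $ j))
      (at (u $ k))"
  proof -
    have coord: "((\<lambda>z. ?line z $ l) has_field_derivative axis k 1 $ l) (at (u $ k))" for l
      by (cases "l = k") (auto simp: axis_def)
    have base: "?line (u $ k) = u"
      by (simp add: vec_eq_iff)
    show ?thesis
      using DERIV_mult[OF DERIV_diff[OF coord[of i] coord[of j]] outer_inverse_partial_derivative[OF u, of k i j]]
      unfolding base by (simp add: algebra_simps)
  qed
  ultimately show "((\<lambda>z. Phi a b (?line z) $ i $ j) has_field_derivative
      ad (ad_inv u (ad (diag_unit k) (Phi a b u))) (Phi a b u) $ i $ j) (at (u $ k))"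
    by (simp add: Phi_eq_ad_outer_inverse ad_diag_mat_nth)
qed

section \<open>The solution and its spectrum\<close>

theorem proposition6p3:
  fixes a :: "complex^'m^'n" and b :: "complex^'n^'m"
  assumes "b ** a = 0"
  shows "rational_on {u. invertible (b ** diag_mat u ** a)} (Phi a b) \<and>
     isomonodromy_solution_on
           {u. inj (\<lambda>i. u $ i) \<and> invertible (b ** diag_mat u ** a)} (Phi a b) \<and>
     (\<forall>v. invertible (b ** diag_mat v ** a) \<longrightarrow>
      (let u = diag_mat v; M = matrix_inv (b ** u ** a); I = mat 1;
           P1 = (I - (1/2) *\<^sub>R (a ** M ** b ** u)) ** (u ** a ** M ** b);
           Pm1 = (a ** M ** b ** u) ** (I - (1/2) *\<^sub>R (u ** a ** M ** b));
           P0 = (I - a ** M ** b ** u) ** (I - u ** a ** M ** b)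
       in rank a = CARD('m) \<and> rank b = CARD('m) \<and> real CARD('m) \<le> real CARD('n) / 2 \<and>
          diagonalizable (Phi a b v) \<and>
          eigenvalue_multiplicity (Phi a b v) 1 = CARD('m) \<and>
          eigenvalue_multiplicity (Phi a b v) (-1) = CARD('m) \<and>
          eigenvalue_multiplicity (Phi a b v) 0 = CARD('n) - 2 * CARD('m) \<and>
          is_spectral_projection (Phi a b v) 1 P1 \<and>
          P1 = u ** a ** M ** b - a ** M ** ((1/2) *\<^sub>R (b ** u ** u ** a)) ** M ** b \<and>
          is_spectral_projection (Phi a b v) (-1) Pm1 \<and>
          Pm1 = a ** M ** b ** u - a ** M ** ((1/2) *\<^sub>R (b ** u ** u ** a)) ** M ** b \<and>
          is_spectral_projection (Phi a b v) 0 P0))"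
proof (intro conjI allI impI)
  have Phi: "Phi a b = (\<lambda>u. ad (diag_mat u) (outer_inverse a b u))"
    by (simp add: fun_eq_iff Phi_eq_ad_outer_inverse)
  show "rational_on {u. invertible (b ** diag_mat u ** a)} (Phi a b)"
    using rational_on_ad_diag[OF rational_on_outer_inverse] by (simp add: Phi regular_points_def)
  show "isomonodromy_solution_on
      {u. inj (\<lambda>i. u $ i) \<and> invertible (b ** diag_mat u ** a)} (Phi a b)"
    using isomonodromy_solution_Phi[OF assms] by (simp add: regular_points_def conj_commute)
  fix v
  assume inv: "invertible (b ** diag_mat v ** a)"
  define u where "u = diag_mat v"
  define M where "M = matrix_inv (b ** u ** a)"
  define P where "P = u ** a ** M ** b"
  define Q where "Q = a ** M ** b ** u"
  define A where "A = Phi a b v"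
  have reg: "v \<in> regular_points a b"
    using inv by (simp add: regular_points_def)
  have M: "M ** (b ** u ** a) = mat 1" "(b ** u ** a) ** M = mat 1"
    using inv by (simp_all add: M_def u_def matrix_inv_mult)
  have X: "outer_inverse a b v = a ** M ** b"
    by (simp add: outer_inverse_def M_def u_def)
  have PX: "P = u ** outer_inverse a b v" and QX: "Q = outer_inverse a b v ** u"
    by (simp_all add: P_def Q_def X matrix_mul_assoc)
  note XX = outer_inverse_square[OF assms, of v] and XUX = outer_inverse_diag_outer_inverse[OF reg, folded u_def]
  have PP: "P ** P = P" and QQ: "Q ** Q = Q" and PQ: "P ** Q = 0"
    unfolding PX QX
    by (metis XUX matrix_mul_assoc, metis XUX matrix_mul_assoc,
        metis XX matrix_mul_assoc matrix_mult_zero(1) matrix_mult_zero(2))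
  have A: "A = P - Q"
    by (simp add: A_def Phi_eq_ad_outer_inverse ad_def PX QX u_def)
  define P1 where "P1 = P - (1/2) *\<^sub>R (Q ** P)"
  define Pm1 where "Pm1 = Q - (1/2) *\<^sub>R (Q ** P)"
  define P0 where "P0 = mat 1 - P - Q + Q ** P"
  note split = idempotent_pair_splitting[OF PP QQ PQ, folded A P1_def Pm1_def P0_def]
  have trP: "trace P = of_nat CARD('m)"
  proof -
    have "trace P = trace ((u ** a) ** (M ** b))"
      by (simp add: P_def matrix_mul_assoc)
    also have "\<dots> = trace (M ** (b ** u ** a))"
      by (subst trace_mul_sym) (simp add: matrix_mul_assoc)
    finally show ?thesis
      by (simp add: M trace_I)
  qed
  have trQ: "trace Q = of_nat CARD('m)"
    using trP unfolding PX QX by (subst trace_mul_sym)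
  have trQP: "trace (Q ** P) = 0"
    using trace_mul_sym[of Q P] by (simp add: PQ trace_def)
  have "of_nat (eigenvalue_multiplicity A 1) = (of_nat CARD('m) :: complex)"
    using trace_spectral_projection[OF split(1,2)]
    by (simp add: P1_def trace_sub trace_scaleR trP trQP)
  then have mult1: "eigenvalue_multiplicity A 1 = CARD('m)"
    using of_nat_eq_iff by blast
  have "of_nat (eigenvalue_multiplicity A (-1)) = (of_nat CARD('m) :: complex)"
    using trace_spectral_projection[OF split(1,3)]
    by (simp add: Pm1_def trace_sub trace_scaleR trQ trQP)
  then have multm1: "eigenvalue_multiplicity A (-1) = CARD('m)"
    using of_nat_eq_iff by blast
  \<comment> \<open>The complex difference is not truncated, so that this equation also yields \<open>2m \<le> n\<close>.\<close>
  have "(of_nat (eigenvalue_multiplicity A 0) :: complex) = of_nat CARD('n) - 2 * of_nat CARD('m)"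
    using trace_spectral_projection[OF split(1,4)]
    by (simp add: P0_def trace_sub trace_add trP trQ trQP trace_I)
  then have "of_nat (eigenvalue_multiplicity A 0 + 2 * CARD('m)) = (of_nat CARD('n) :: complex)"
    by simp
  then have mult0: "eigenvalue_multiplicity A 0 + 2 * CARD('m) = CARD('n)"
    using of_nat_eq_iff by blast
  have rank_a: "rank a = CARD('m)"
    by (rule rank_eq_if_left_inverse[of "M ** b ** u"]) (use M in \<open>simp add: matrix_mul_assoc\<close>)
  have rank_b: "rank b = CARD('m)"
    by (rule rank_eq_if_right_inverse[of _ "u ** a ** M"]) (use M in \<open>simp add: matrix_mul_assoc\<close>)
  have P1': "(mat 1 - (1/2) *\<^sub>R Q) ** P = P1" and Pm1': "Q ** (mat 1 - (1/2) *\<^sub>R P) = Pm1"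
    and P0': "(mat 1 - Q) ** (mat 1 - P) = P0"
    by (simp_all add: P1_def Pm1_def P0_def matrix_diff_ldistrib matrix_diff_rdistrib
        scalar_matrix_assoc[symmetric] matrix_scalar_ac)
  have QP: "a ** M ** ((1/2) *\<^sub>R (b ** u ** u ** a)) ** M ** b = (1/2) *\<^sub>R (Q ** P)"
    by (simp add: P_def Q_def matrix_scalar_ac scalar_matrix_assoc[symmetric] matrix_mul_assoc)
  show "let u = diag_mat v; M = matrix_inv (b ** u ** a); I = mat 1;
           P1 = (I - (1/2) *\<^sub>R (a ** M ** b ** u)) ** (u ** a ** M ** b);
           Pm1 = (a ** M ** b ** u) ** (I - (1/2) *\<^sub>R (u ** a ** M ** b));
           P0 = (I - a ** M ** b ** u) ** (I - u ** a ** M ** b)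
       in rank a = CARD('m) \<and> rank b = CARD('m) \<and> real CARD('m) \<le> real CARD('n) / 2 \<and>
          diagonalizable (Phi a b v) \<and>
          eigenvalue_multiplicity (Phi a b v) 1 = CARD('m) \<and>
          eigenvalue_multiplicity (Phi a b v) (-1) = CARD('m) \<and>
          eigenvalue_multiplicity (Phi a b v) 0 = CARD('n) - 2 * CARD('m) \<and>
          is_spectral_projection (Phi a b v) 1 P1 \<and>
          P1 = u ** a ** M ** b - a ** M ** ((1/2) *\<^sub>R (b ** u ** u ** a)) ** M ** b \<and>
          is_spectral_projection (Phi a b v) (-1) Pm1 \<and>
          Pm1 = a ** M ** b ** u - a ** M ** ((1/2) *\<^sub>R (b ** u ** u ** a)) ** M ** b \<and>
          is_spectral_projection (Phi a b v) 0 P0"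
    unfolding Let_def u_def[symmetric] M_def[symmetric] P_def[symmetric] Q_def[symmetric]
      A_def[symmetric] P1' Pm1' P0' QP P1_def[symmetric] Pm1_def[symmetric]
    using rank_a rank_b mult0 mult1 multm1 split by simp
qed

end
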